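(* Let $(X_1,\dots,X_n)$ be an exchangeable occupancy model on $A_{n,r}$ and let $(X''_1,\dots,X''_{n-1})$ be the occupancy numbers obtained by applying the transformation $\mathcal{K}_2$ (erasing the $n$-th cell and redistributing its particles independently and uniformly among the remaining cells). Then $(X''_1,\dots,X''_{n-1})$ is an exchangeable occupancy model on $A_{n-1,r}$.
   Context: For integers $n\ge1$, $r\ge0$, $A_{n,r}$ is the set of vectors $(x_1,\dots,x_n)$ of non-negative integers with $\sum_{j=1}^n x_j=r$; in the statement $n\ge2$, $r\ge1$. An occupancy model on $A_{n,r}$ is a probability distribution on $A_{n,r}$ (equivalently, the law of a random vector $(X_1,\dots,X_n)$ with values in $A_{n,r}$; $X_j$ counts the particles in cell $j$). It is an exchangeable occupancy model if $(X_1,\dots,X_n)$ is exchangeable, i.e. its law is invariant under all permutations of the coordinates. Transformation $\mathcal{K}_2$: the $n$-th cell is eliminated and each of the $X_n$ particles in it is put at random (uniformly), and independently, in one of the remaining $n-1$ cells. The resulting occupancy numbers $(X''_1,\dots,X''_{n-1})$ have law, for $(x''_1,\dots,x''_{n-1})\in A_{n-1,r}$, $$P\{X''_1=x''_1,\dots,X''_{n-1}=x''_{n-1}\}=\sum_{x=0}^{r}\ \sum_{\xi\in A_{n-1,x}}\frac{1}{(n-1)^x}\frac{x!}{\xi_1!\cdots\xi_{n-1}!}\,P\{X_1=x''_1-\xi_1,\dots,X_{n-1}=x''_{n-1}-\xi_{n-1},X_n=x\},$$ where the probability on the right is $0$ whenever some $x''_j-\xi_j<0$. *)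

theory Defs
  imports "HOL-Probability.Probability" "HOL-Combinatorics.Combinatorics"
begin

text \<open>
  A configuration of \<open>r\<close> particles in \<open>n\<close> cells is a list of length \<open>n\<close>; cells are numbered from
  \<open>0\<close> to \<open>n - 1\<close>. A random vector is represented by its law, a \<open>pmf\<close> on lists.
\<close>

definition configurations :: "nat \<Rightarrow> nat \<Rightarrow> nat list set" where
  "configurations n r = {xs. length xs = n \<and> sum_list xs = r}"

definition occupancy_model :: "nat \<Rightarrow> nat \<Rightarrow> nat list pmf \<Rightarrow> bool" where
  "occupancy_model n r p \<longleftrightarrow> set_pmf p \<subseteq> configurations n r"

definition exchangeable_occupancy_model :: "nat \<Rightarrow> nat \<Rightarrow> nat list pmf \<Rightarrow> bool" where
  "exchangeable_occupancy_model n r p \<longleftrightarrow>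
     occupancy_model n r p \<and>
     (\<forall>\<pi>. \<pi> permutes {..<n} \<longrightarrow> map_pmf (permute_list \<pi>) p = p)"

text \<open>
  The last cell of \<open>xs\<close> is erased. Its particles get independent destinations \<open>ds\<close>, uniform on the
  remaining \<open>n - 1\<close> cells; \<open>count_list ds j\<close> of them land in cell \<open>j\<close>. For \<open>n \<le> 1\<close> no cell remains
  and the value of the function is meaningless.
\<close>

definition K2 :: "nat \<Rightarrow> nat list pmf \<Rightarrow> nat list pmf" where
  "K2 n p = do {
     xs \<leftarrow> p;
     ds \<leftarrow> replicate_pmf (xs ! (n - 1)) (pmf_of_set {..<n - 1});
     return_pmf (map (\<lambda>j. xs ! j + count_list ds j) [0..<n - 1])
   }"

text \<open>The rest of this theory derives the explicit mass function of \<^term>\<open>K2 n p\<close>.\<close>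

lemma finite_configurations [simp]: "finite (configurations n r)"
proof (rule finite_subset)
  show "configurations n r \<subseteq> {xs. set xs \<subseteq> {..r} \<and> length xs = n}"
    by (auto simp: configurations_def member_le_sum_list)
  show "finite {xs. set xs \<subseteq> {..r} \<and> length xs = n}"
    by (rule finite_lists_length_eq) simp
qed

lemma replicate_pmf_of_set:
  assumes "finite A" "A \<noteq> {}"
  shows "pmf (replicate_pmf k (pmf_of_set A)) ds =
           (if length ds = k \<and> set ds \<subseteq> A then 1 / real (card A) ^ k else 0)"
proof (induction k arbitrary: ds)
  case 0
  then show ?case by (auto simp: indicator_def)
next
  case (Suc k)
  have *: "replicate_pmf (Suc k) (pmf_of_set A) =
      map_pmf (\<lambda>(x, xs). x # xs) (pair_pmf (pmf_of_set A) (replicate_pmf k (pmf_of_set A)))"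
    by (simp add: pair_pmf_def map_pmf_def bind_assoc_pmf bind_return_pmf)
  show ?case
  proof (cases ds)
    case Nil
    have "[] \<notin> set_pmf (replicate_pmf (Suc k) (pmf_of_set A))"
      by (subst set_replicate_pmf) simp
    with Nil show ?thesis by (simp del: replicate_pmf.simps add: set_pmf_iff)
  next
    case (Cons d ds')
    have "pmf (replicate_pmf (Suc k) (pmf_of_set A)) ((\<lambda>(x, xs). x # xs) (d, ds')) =
          pmf (pair_pmf (pmf_of_set A) (replicate_pmf k (pmf_of_set A))) (d, ds')"
      unfolding * by (rule pmf_map_inj') (auto simp: inj_on_def)
    then show ?thesis
      using assms Cons by (auto simp: pmf_pair Suc.IH indicator_def simp del: replicate_pmf.simps)
  qed
qed

lemma sum_list_count_list:
  assumes "set ds \<subseteq> {..<m}"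
  shows "sum_list (map (count_list ds) [0..<m]) = length ds"
  using sum_count_set[OF assms] by (simp add: interv_sum_list_conv_sum_set_nat atLeast0LessThan)

lemma card_destinations:
  assumes "\<xi> \<in> configurations m k"
  shows "real (card {ds. set ds \<subseteq> {..<m} \<and> map (count_list ds) [0..<m] = \<xi>}) =
           fact k / (\<Prod>j<m. fact (\<xi> ! j))"
proof -
  define A where "A = (\<Sum>j<m. replicate_mset (\<xi> ! j) j)"
  have len: "length \<xi> = m" and sum: "sum_list \<xi> = k"
    using assms by (auto simp: configurations_def)
  have cnt: "count A j = (if j < m then \<xi> ! j else 0)" for j
    unfolding A_def by (simp add: count_sum)
  have sz: "size A = k"
    using sum len unfolding A_def by (simp add: size_multiset_sum sum_list_sum_nth atLeast0LessThan)
  have cl: "count_list ds j = count (mset ds) j" for ds :: "nat list" and j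
    by (induction ds) auto
  have "{ds. set ds \<subseteq> {..<m} \<and> map (count_list ds) [0..<m] = \<xi>} = permutations_of_multiset A"
    (is "?L = ?R")
  proof (intro set_eqI iffI)
    fix ds assume ds: "ds \<in> ?L"
    have "count (mset ds) j = count A j" for j
    proof (cases "j < m")
      case True
      then have "\<xi> ! j = count_list ds j" using ds by auto
      with True show ?thesis by (simp add: cnt cl)
    next
      case False
      then have "j \<notin> set ds" using ds by auto
      with False show ?thesis by (simp add: cnt count_eq_zero_iff)
    qed
    then show "ds \<in> ?R" by (intro permutations_of_multisetI multiset_eqI)
  next
    fix ds assume "ds \<in> ?R"
    then have ds: "mset ds = A" by (rule permutations_of_multisetD)
    have "set ds \<subseteq> {..<m}"
    proof
      fix j assume "j \<in> set ds"
      then have "count A j \<noteq> 0" using ds by (metis count_eq_zero_iff set_mset_mset)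
      then show "j \<in> {..<m}" by (simp add: cnt split: if_splits)
    qed
    then show "ds \<in> ?L" using len by (auto simp: cl ds cnt intro!: nth_equalityI)
  qed
  moreover have "(\<Prod>x\<in>set_mset A. fact (count A x)) = (\<Prod>j<m. fact (\<xi> ! j) :: nat)"
    by (rule prod.mono_neutral_cong_left) (auto simp: cnt not_in_iff simp flip: count_greater_zero_iff split: if_splits)
  ultimately have "card {ds. set ds \<subseteq> {..<m} \<and> map (count_list ds) [0..<m] = \<xi>} * (\<Prod>j<m. fact (\<xi> ! j)) = fact k"
    using card_permutations_of_multiset_aux[of A] sz by simp
  from arg_cong[OF this, of real] show ?thesis
    by (simp add: divide_simps of_nat_prod)
qed

lemma pmf_uniform_occupancy:
  assumes "m > 0"
  shows "pmf (map_pmf (\<lambda>ds. map (count_list ds) [0..<m]) (replicate_pmf k (pmf_of_set {..<m}))) \<xi> =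
           (if \<xi> \<in> configurations m k
            then 1 / real m ^ k * (fact k / (\<Prod>j<m. fact (\<xi> ! j))) else 0)"
    (is "pmf (map_pmf ?f ?q) \<xi> = _")
proof (cases "\<xi> \<in> configurations m k")
  case True
  define D where "D = {ds. set ds \<subseteq> {..<m} \<and> map (count_list ds) [0..<m] = \<xi>}"
  have Dlen: "length ds = k" if "ds \<in> D" for ds
    using that True sum_list_count_list[of ds m] by (auto simp: D_def configurations_def)
  have fin: "finite D"
    by (rule finite_subset[OF _ finite_lists_length_eq[of "{..<m}" k]]) (use Dlen in \<open>auto simp: D_def\<close>)
  have spt: "set_pmf ?q = {ds. set ds \<subseteq> {..<m} \<and> length ds = k}"
    using assms by (subst set_replicate_pmf) (auto simp: set_pmf_of_set lessThan_empty_iff)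
  have "pmf (map_pmf ?f ?q) \<xi> = measure ?q (?f -` {\<xi>})"
    by (simp add: pmf_map)
  also have "\<dots> = measure ?q D"
    by (intro measure_prob_cong_0) (auto simp: D_def set_pmf_iff[symmetric] spt pmf_eq_0_set_pmf)
  also have "\<dots> = (\<Sum>ds\<in>D. pmf ?q ds)"
    by (rule measure_measure_pmf_finite[OF fin])
  also have "\<dots> = (\<Sum>ds\<in>D. 1 / real m ^ k)"
    using assms Dlen
    by (intro sum.cong) (auto simp: replicate_pmf_of_set lessThan_empty_iff D_def)
  also have "\<dots> = 1 / real m ^ k * real (card D)" by simp
  also note card_destinations[OF True, folded D_def]
  finally show ?thesis using True by simp
next
  case False
  have "\<xi> \<notin> set_pmf (map_pmf ?f ?q)"
  proof
    assume "\<xi> \<in> set_pmf (map_pmf ?f ?q)"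
    then obtain ds where "set ds \<subseteq> {..<m}" "length ds = k" "\<xi> = ?f ds"
      using assms by (auto simp: set_replicate_pmf lessThan_empty_iff)
    then show False using False sum_list_count_list[of ds m] by (auto simp: configurations_def)
  qed
  then show ?thesis using False by (simp only: set_pmf_iff not_not if_False)
qed

theorem pmf_K2:
  assumes "n \<ge> 2" and p: "occupancy_model n r p" and ys: "ys \<in> configurations (n - 1) r"
  shows "pmf (K2 n p) ys =
    (\<Sum>x\<le>r. \<Sum>\<xi>\<in>configurations (n - 1) x.
       1 / real (n - 1) ^ x * (fact x / (\<Prod>j<n - 1. fact (\<xi> ! j))) *
       (if \<forall>j<n - 1. \<xi> ! j \<le> ys ! j
        then pmf p (map (\<lambda>j. ys ! j - \<xi> ! j) [0..<n - 1] @ [x]) else 0))"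
proof -
  define m where "m = n - 1"
  have m: "m > 0" "n = Suc m" using assms(1) by (auto simp: m_def)
  define M where "M = (\<lambda>x \<xi>. 1 / real m ^ x * (fact x / (\<Prod>j<m. fact (\<xi> ! j))))"
  define add where "add = (\<lambda>xs \<xi>. map (\<lambda>j. xs ! j + \<xi> ! j) [0..<m] :: nat list)"
  define q where "q = (\<lambda>k. map_pmf (\<lambda>ds. map (count_list ds) [0..<m]) (replicate_pmf k (pmf_of_set {..<m})))"
  have K2: "K2 n p = bind_pmf p (\<lambda>xs. map_pmf (add xs) (q (xs ! m)))"
    unfolding K2_def m_def[symmetric] q_def add_def map_pmf_comp
    by (auto simp: map_pmf_def intro!: bind_pmf_cong)
  have q: "pmf (q k) \<xi> = (if \<xi> \<in> configurations m k then M k \<xi> else 0)" for k \<xi>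
    unfolding q_def M_def using pmf_uniform_occupancy[OF m(1)] .
  have inner: "pmf (map_pmf (add xs) (q k)) ys =
      (\<Sum>\<xi>\<in>configurations m k. if add xs \<xi> = ys then M k \<xi> else 0)" for xs k
  proof -
    have "pmf (map_pmf (add xs) (q k)) ys = measure (q k) (add xs -` {ys})"
      by (simp add: pmf_map)
    also have "\<dots> = measure (q k) {\<xi> \<in> configurations m k. add xs \<xi> = ys}"
      by (intro measure_prob_cong_0) (auto simp: q)
    also have "\<dots> = (\<Sum>\<xi> | \<xi> \<in> configurations m k \<and> add xs \<xi> = ys. M k \<xi>)"
      by (subst measure_measure_pmf_finite) (auto simp: q)
    finally show ?thesis by (simp add: sum.inter_filter)
  qed
  let ?S = "SIGMA xs:configurations n r. configurations m (xs ! m)"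
  let ?T = "SIGMA x:{..r}. configurations m x"
  let ?sub = "\<lambda>\<xi>. map (\<lambda>j. ys ! j - \<xi> ! j) [0..<m]"
  have "pmf (K2 n p) ys = (\<integral>xs. pmf (map_pmf (add xs) (q (xs ! m))) ys \<partial>p)"
    by (simp add: K2 pmf_bind)
  also have "\<dots> = (\<Sum>xs\<in>configurations n r. pmf (map_pmf (add xs) (q (xs ! m))) ys * pmf p xs)"
    by (rule integral_measure_pmf_real) (use p in \<open>auto simp: occupancy_model_def\<close>)
  also have "\<dots> = (\<Sum>xs\<in>configurations n r. \<Sum>\<xi>\<in>configurations m (xs ! m).
                    if add xs \<xi> = ys then M (xs ! m) \<xi> * pmf p xs else 0)"
    by (auto simp: inner sum_distrib_right intro!: sum.cong)
  also have "\<dots> = (\<Sum>(xs, \<xi>)\<in>?S. if add xs \<xi> = ys then M (xs ! m) \<xi> * pmf p xs else 0)"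
    by (subst sum.Sigma) auto
  also have "\<dots> = (\<Sum>(xs, \<xi>)\<in>{(xs, \<xi>) \<in> ?S. add xs \<xi> = ys}. M (xs ! m) \<xi> * pmf p xs)"
    by (rule sum.mono_neutral_cong_right) (auto intro!: finite_SigmaI split: if_splits)
  also have "\<dots> = (\<Sum>(x, \<xi>)\<in>{(x, \<xi>) \<in> ?T. \<forall>j<m. \<xi> ! j \<le> ys ! j}. M x \<xi> * pmf p (?sub \<xi> @ [x]))"
  proof (rule sum.reindex_bij_witness[where j = "\<lambda>(xs, \<xi>). (xs ! m, \<xi>)" and i = "\<lambda>(x, \<xi>). (?sub \<xi> @ [x], \<xi>)"], goal_cases)
    case (1 a)
    then obtain xs \<xi> where a: "a = (xs, \<xi>)" and len: "length xs = Suc m" and e: "add xs \<xi> = ys"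
      by (auto simp: configurations_def m)
    have "?sub \<xi> @ [xs ! m] = xs"
      using len by (auto simp: list_eq_iff_nth_eq nth_append less_Suc_eq e[symmetric] add_def)
    then show ?case by (simp add: a)
  next
    case (2 a)
    then obtain xs \<xi> where a: "a = (xs, \<xi>)" and xs: "xs \<in> configurations n r"
      and \<xi>: "\<xi> \<in> configurations m (xs ! m)" and e: "add xs \<xi> = ys"
      by auto
    have "xs ! m \<le> r" using xs by (auto simp: configurations_def m member_le_sum_list)
    moreover have "\<xi> ! j \<le> ys ! j" if "j < m" for j using that by (simp add: e[symmetric] add_def)
    ultimately show ?case using \<xi> by (simp add: a)
  next
    case (3 b)
    then show ?case by (auto simp: nth_append)
  next
    case (4 b)
    then obtain x \<xi> where b: "b = (x, \<xi>)" and x: "x \<le> r" and \<xi>: "\<xi> \<in> configurations m x"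
      and le: "\<forall>j<m. \<xi> ! j \<le> ys ! j" by auto
    have lens: "length ys = m" "sum_list ys = r" "length \<xi> = m" "sum_list \<xi> = x"
      using ys \<xi> by (auto simp: configurations_def m)
    have "sum_list (?sub \<xi>) = (\<Sum>j<m. ys ! j - \<xi> ! j)"
      by (simp add: interv_sum_list_conv_sum_set_nat atLeast0LessThan)
    also have "\<dots> = (\<Sum>j<m. ys ! j) - (\<Sum>j<m. \<xi> ! j)"
      using le by (intro sum_subtractf_nat) auto
    also have "\<dots> = r - x"
      using lens by (simp add: sum_list_sum_nth atLeast0LessThan)
    finally have "?sub \<xi> @ [x] \<in> configurations n r" using x by (simp add: configurations_def m)
    moreover have "add (?sub \<xi> @ [x]) \<xi> = ys"
      using le lens by (auto simp: add_def list_eq_iff_nth_eq nth_append)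
    ultimately show ?case using \<xi> by (simp add: b nth_append)
  next
    case (5 a)
    then obtain xs \<xi> where a: "a = (xs, \<xi>)" and len: "length xs = Suc m" and e: "add xs \<xi> = ys"
      by (auto simp: configurations_def m)
    have "?sub \<xi> @ [xs ! m] = xs"
      using len by (auto simp: list_eq_iff_nth_eq nth_append less_Suc_eq e[symmetric] add_def)
    then show ?case by (simp add: a)
  qed
  also have "\<dots> = (\<Sum>(x, \<xi>)\<in>?T. M x \<xi> * (if \<forall>j<m. \<xi> ! j \<le> ys ! j then pmf p (?sub \<xi> @ [x]) else 0))"
    by (rule sum.mono_neutral_cong_left) (auto intro!: finite_SigmaI split: if_splits)
  also have "\<dots> = (\<Sum>x\<le>r. \<Sum>\<xi>\<in>configurations m x. M x \<xi> * (if \<forall>j<m. \<xi> ! j \<le> ys ! j then pmf p (?sub \<xi> @ [x]) else 0))"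
    by (subst sum.Sigma) auto
  finally show ?thesis unfolding M_def m_def .
qed

end

theory Submission
  imports Defs
begin

text \<open>
  The kernel redistributing the last cell commutes with any permutation \<open>\<pi>\<close> of the remaining
  cells: relabelling the destinations by the inverse of \<open>\<pi>\<close> preserves their uniform law. Extended
  to fix the last cell, \<open>\<pi>\<close> leaves the law of the initial configuration invariant.
\<close>

text \<open>Independent samples stay independent when \<open>f\<close> is applied to each of them.
  This carries invariance of the uniform law from one destination to the whole list.\<close>

lemma map_replicate_pmf: "map_pmf (map f) (replicate_pmf k q) = replicate_pmf k (map_pmf f q)"
proof (induction k)
  case (Suc k)
  have "map_pmf (map f) (replicate_pmf (Suc k) q) =
      q \<bind> (\<lambda>x. map_pmf ((#) (f x)) (map_pmf (map f) (replicate_pmf k q)))"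
    by (simp add: map_bind_pmf map_pmf_comp o_def flip: map_pmf_def)
  then show ?case
    by (simp add: Suc.IH bind_map_pmf flip: map_pmf_def)
qed simp

text \<open>The kernel for one fixed configuration. Here \<open>m\<close> counts the remaining
  cells, so \<open>xs ! m\<close> is the erased one.\<close>

definition redistribute_last :: "nat \<Rightarrow> nat list \<Rightarrow> nat list pmf" where
  "redistribute_last m xs =
     map_pmf (\<lambda>ds. map (\<lambda>j. xs ! j + count_list ds j) [0..<m])
       (replicate_pmf (xs ! m) (pmf_of_set {..<m}))"

lemma K2_eq_bind_redistribute_last: "K2 n p = p \<bind> redistribute_last (n - 1)"
  by (simp add: K2_def redistribute_last_def[abs_def] map_pmf_def)

text \<open>A coupling argument: destinations \<open>ds\<close> on the left are matched with
  \<open>map (inv \<pi>) ds\<close> on the right, after which both outcomes agree for every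
  \<open>ds\<close>.\<close>

lemma redistribute_last_permute:
  assumes m: "m > 0" and \<pi>: "\<pi> permutes {..<m}" and len: "length xs = Suc m"
  shows "map_pmf (permute_list \<pi>) (redistribute_last m xs) = redistribute_last m (permute_list \<pi> xs)"
proof -
  let ?q = "pmf_of_set {..<m}"
  have \<pi>': "\<pi> permutes {..<length xs}"
    using permutes_subset[OF \<pi>] len by auto
  \<comment> \<open>As \<open>\<pi>\<close> fixes \<open>m\<close>, both sides redistribute the same
    number of particles.\<close>
  have last: "permute_list \<pi> xs ! m = xs ! m"
    using len permutes_not_in[OF \<pi>, of m] by (simp add: permute_list_nth[OF \<pi>'])
  have inv_pi: "inv \<pi> permutes {..<m}"
    by (rule permutes_inv[OF \<pi>])
  have "map_pmf (inv \<pi>) ?q = ?q"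
    using m permutes_inj_on[OF inv_pi] permutes_image[OF inv_pi]
    by (subst map_pmf_of_set_inj) auto
  then have relabel: "map_pmf (map (inv \<pi>)) (replicate_pmf (xs ! m) ?q) = replicate_pmf (xs ! m) ?q"
    by (simp add: map_replicate_pmf)
  have "redistribute_last m (permute_list \<pi> xs) =
      map_pmf (\<lambda>ds. map (\<lambda>j. permute_list \<pi> xs ! j + count_list (map (inv \<pi>) ds) j) [0..<m])
        (replicate_pmf (xs ! m) ?q)"
    unfolding redistribute_last_def last
    \<comment> \<open>The law of the destinations also occurs on the right, where it must stay; only
      the first occurrence is replaced.\<close>
    by (subst (1) relabel[symmetric]) (simp only: map_pmf_comp)
  moreover have "permute_list \<pi> (map (\<lambda>j. xs ! j + count_list ds j) [0..<m]) =
      map (\<lambda>j. permute_list \<pi> xs ! j + count_list (map (inv \<pi>) ds) j) [0..<m]" for ds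
  proof (rule nth_equalityI)
    fix j assume "j < length (permute_list \<pi> (map (\<lambda>j. xs ! j + count_list ds j) [0..<m]))"
    then have j: "j < m" by simp
    then have "\<pi> j < m" using permutes_in_image[OF \<pi>, of j] by simp
    \<comment> \<open>The inverse is needed because \<open>permute_list \<pi>\<close> puts entry
      \<open>\<pi> j\<close> at position \<open>j\<close>, so a particle bound for
      \<open>\<pi> j\<close> must be sent to \<open>j\<close>.\<close>
    moreover have "count_list (map (inv \<pi>) ds) j = count_list ds (\<pi> j)"
      using count_list_map_conv[OF permutes_inj[OF inv_pi], of ds "\<pi> j"] permutes_inverses[OF \<pi>] by simp
    ultimately show "permute_list \<pi> (map (\<lambda>j. xs ! j + count_list ds j) [0..<m]) ! j =
        map (\<lambda>j. permute_list \<pi> xs ! j + count_list (map (inv \<pi>) ds) j) [0..<m] ! j"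
      using j len \<pi> by (simp add: permute_list_nth[OF \<pi>'] permute_list_nth)
  qed simp
  ultimately show ?thesis
    by (simp add: redistribute_last_def map_pmf_comp)
qed

text \<open>Particles are conserved: the \<open>m\<close> kept cells and the \<open>xs ! m\<close>
  destinations together account for all \<open>r\<close>. Since \<open>m > 0\<close>, the uniform
  law lives on a nonempty set.\<close>

lemma set_redistribute_last:
  assumes "m > 0" and "xs \<in> configurations (Suc m) r"
  shows "set_pmf (redistribute_last m xs) \<subseteq> configurations m r"
proof
  fix ys assume "ys \<in> set_pmf (redistribute_last m xs)"
  then obtain ds where ds: "set ds \<subseteq> {..<m}" "length ds = xs ! m"
    and ys: "ys = map (\<lambda>j. xs ! j + count_list ds j) [0..<m]"
    using assms(1) by (auto simp: redistribute_last_def set_replicate_pmf lessThan_empty_iff)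
  have "sum_list ys = (\<Sum>j<m. xs ! j) + length ds"
    using sum_list_count_list[OF ds(1)] unfolding ys sum_list_addf
    by (simp add: interv_sum_list_conv_sum_set_nat atLeast0LessThan)
  also have "\<dots> = r"
    using assms(2) ds(2) by (auto simp: configurations_def sum_list_sum_nth atLeast0LessThan)
  finally show "ys \<in> configurations m r"
    by (simp add: configurations_def ys)
qed

theorem proposition6p4:
  fixes n r :: nat and p :: "nat list pmf"
  assumes "n \<ge> 2" and "r \<ge> 1"
    and "exchangeable_occupancy_model n r p"
  shows "exchangeable_occupancy_model (n - 1) r (K2 n p)"
proof -
  obtain m where n: "n = Suc m" and m: "m > 0"
    using assms(1) by (cases n) auto
  have supp: "set_pmf p \<subseteq> configurations (Suc m) r"
    and exch: "\<And>\<pi>. \<pi> permutes {..<Suc m} \<Longrightarrow> map_pmf (permute_list \<pi>) p = p"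
    using assms(3) by (auto simp: exchangeable_occupancy_model_def occupancy_model_def n)
  have K2: "K2 n p = p \<bind> redistribute_last m"
    by (simp add: K2_eq_bind_redistribute_last n)
  have "occupancy_model m r (K2 n p)"
    using set_redistribute_last[OF m] supp by (auto simp: occupancy_model_def K2)
  moreover have "map_pmf (permute_list \<pi>) (K2 n p) = K2 n p" if \<pi>: "\<pi> permutes {..<m}" for \<pi>
  proof -
    have "map_pmf (permute_list \<pi>) (K2 n p) = p \<bind> (\<lambda>xs. redistribute_last m (permute_list \<pi> xs))"
      \<comment> \<open>The kernels need to agree only on the support of \<open>p\<close>, where
        every list has length \<open>Suc m\<close>.\<close>
      unfolding K2 map_bind_pmf using supp
      by (intro bind_pmf_cong redistribute_last_permute[OF m \<pi>]) (auto simp: configurations_def)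
    also have "\<dots> = map_pmf (permute_list \<pi>) p \<bind> redistribute_last m"
      by (simp add: bind_map_pmf)
    also have "\<dots> = K2 n p"
      using permutes_subset[OF \<pi>, of "{..<Suc m}"] by (simp add: K2 exch)
    finally show ?thesis .
  qed
  ultimately show ?thesis
    by (simp add: exchangeable_occupancy_model_def n)
qed

end
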